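(* Let $M$ be an $N$-dimensional smooth manifold ($N\ge 2$) with a Riemannian metric $a_{ij}(x)$ and a 1-form $b_i(x)$ of unit Riemannian length, $a^{ij}b_ib_j=1$. Put $S=\sqrt{a_{ij}(x)y^iy^j}$, $b=b_i(x)y^i$, $b^i=a^{ij}b_j$, $q=\sqrt{S^2-b^2}$, $v^i=y^i-b\,b^i$, and let $a^i{}_{km}$ be the Christoffel symbols of $a_{ij}$. Let $F(x,y)$ be a Finsler metric function on $M$ satisfying the following two conditions. (i) The geodesic spray coefficients $G^i=\gamma^i{}_{nm}y^ny^m$ of $F$ have the form $$G^i=c(x)\,q\,v^i+a^i{}_{km}(x)y^ky^m$$ with some scalar function $c=c(x)$ on $M$. (ii) $F$ is obtained from a function $\breve F$ of two variables by $F(x,y)=\breve F\bigl(S(x,y),b(x,y)\bigr)$. Then, at all $(x,y)\in TM\setminus 0$ with $q(x,y)\neq 0$, $$y_i\,G^i{}_{kmn}=0\qquad\text{for all }k,m,n,$$ where $y_i=\frac12\,\partial F^2/\partial y^i$ and $G^i{}_{kmn}=\partial^3G^i/\partial y^k\partial y^m\partial y^n$. Hence $F$ defines a Landsberg-type Finsler space.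
   Context: Conventions. $(x^i,y^i)$ are standard local coordinates on $TM$, and repeated indices are summed from $1$ to $N$. $a^{ij}$ is the inverse of $a_{ij}$, and $a^k{}_{ij}=\frac12a^{kn}(\partial_ja_{ni}+\partial_ia_{nj}-\partial_na_{ji})$ with $\partial_j=\partial/\partial x^j$. The Finslerian metric tensor of $F$ is $g_{ij}=\frac12\,\partial^2F^2/\partial y^i\partial y^j$, with inverse $g^{ij}$. The Finslerian Christoffel symbols are $\gamma^k{}_{ij}=\frac12g^{kn}(\partial_jg_{ni}+\partial_ig_{nj}-\partial_ng_{ji})$. The Finsler geodesic spray coefficients are normalized as $G^k=\gamma^k{}_{ij}y^iy^j$ (no factor $\frac12$), so that geodesics satisfy $\ddot c^i+G^i(\dot c)=0$. A Finsler metric function is positively homogeneous of degree $1$ in $y$, with $g_{ij}$ nondegenerate. $F$ is assumed smooth on the part of $TM\setminus 0$ where $q\neq0$, i.e. where $y$ is not proportional to the vector $b^i$; smoothness where $q=0$ is not required. The space is of Landsberg type if the tensor $\dot A_{jkl}=-\frac14\,y_i\,\dfrac{\partial^3G^i}{\partial y^j\partial y^k\partial y^l}$ vanishes identically (where defined). *)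

theory Defs
  imports "HOL-Analysis.Analysis"
begin

subsection \<open>Smooth functions on open sets and partial derivatives\<close>

fun Ck_on :: "nat \<Rightarrow> 'a::euclidean_space set \<Rightarrow> ('a \<Rightarrow> 'b::real_normed_vector) \<Rightarrow> bool" where
  "Ck_on 0 U f \<longleftrightarrow> continuous_on U f"
| "Ck_on (Suc k) U f \<longleftrightarrow>
     (\<forall>x\<in>U. f differentiable (at x)) \<and>
     (\<forall>e\<in>Basis. Ck_on k U (\<lambda>x. frechet_derivative f (at x) e))"

text \<open>Only meant for open \<open>U\<close>, since the derivatives are taken at \<^term>\<open>at x\<close>.\<close>

definition smooth_on :: "'a::euclidean_space set \<Rightarrow> ('a \<Rightarrow> 'b::real_normed_vector) \<Rightarrow> bool" where
  "smooth_on U f \<longleftrightarrow> (\<forall>k. Ck_on k U f)"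

definition pd :: "'n::finite \<Rightarrow> (real^'n \<Rightarrow> real) \<Rightarrow> real^'n \<Rightarrow> real" where
  "pd i f x = deriv (\<lambda>t. f (x + t *\<^sub>R axis i 1)) 0"


subsection \<open>Smooth manifolds\<close>

text \<open>A chart is a pair of a subset of the manifold and a coordinate map, of which only the
  restriction to that subset matters.\<close>

type_synonym ('m, 'n) chart = "'m set \<times> ('m \<Rightarrow> (real, 'n) vec)"

definition chart_img :: "('m, 'n::finite) chart \<Rightarrow> (real^'n) set" where
  "chart_img \<kappa> = snd \<kappa> ` fst \<kappa>"

definition chart_inv :: "('m, 'n::finite) chart \<Rightarrow> real^'n \<Rightarrow> 'm" where
  "chart_inv \<kappa> = inv_into (fst \<kappa>) (snd \<kappa>)"

definition overlap :: "('m, 'n::finite) chart \<Rightarrow> ('m, 'n) chart \<Rightarrow> (real^'n) set" where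
  "overlap \<kappa> \<kappa>' = snd \<kappa> ` (fst \<kappa> \<inter> fst \<kappa>')"

definition transition :: "('m, 'n::finite) chart \<Rightarrow> ('m, 'n) chart \<Rightarrow> real^'n \<Rightarrow> real^'n" where
  "transition \<kappa> \<kappa>' = snd \<kappa>' \<circ> chart_inv \<kappa>"

text \<open>The atlas need not be maximal; instantiating it with a maximal one covers all local
  coordinate systems.\<close>

definition smooth_manifold :: "'m topology \<Rightarrow> ('m, 'n::finite) chart set \<Rightarrow> bool" where
  "smooth_manifold M A \<longleftrightarrow>
     Hausdorff_space M \<and> second_countable M \<and>
     (\<Union>\<kappa>\<in>A. fst \<kappa>) = topspace M \<and>
     (\<forall>\<kappa>\<in>A. openin M (fst \<kappa>) \<and> open (chart_img \<kappa>) \<and>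
        homeomorphic_map (subtopology M (fst \<kappa>)) (top_of_set (chart_img \<kappa>)) (snd \<kappa>)) \<and>
     (\<forall>\<kappa>\<in>A. \<forall>\<kappa>'\<in>A. smooth_on (overlap \<kappa> \<kappa>') (transition \<kappa> \<kappa>'))"


subsection \<open>Tensor fields and functions on the slit tangent bundle\<close>

text \<open>Fields on the manifold and functions on the slit tangent bundle are given by their
  components in each chart \<open>\<kappa>\<close>, as functions of the coordinates \<open>x\<close> (and \<open>y\<close>), subject to the usual
  transformation laws under change of chart. Below, \<open>J\<close> has the entries
  \<open>J $ k $ i = \<partial>x'\<^sup>k/\<partial>x\<^sup>i\<close>.\<close>

definition riemannian_metric ::
    "('m, 'n::finite) chart set \<Rightarrow> (('m, 'n) chart \<Rightarrow> real^'n \<Rightarrow> real^'n^'n) \<Rightarrow> bool" where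
  "riemannian_metric A a \<longleftrightarrow>
     (\<forall>\<kappa>\<in>A. smooth_on (chart_img \<kappa>) (a \<kappa>) \<and>
        (\<forall>x\<in>chart_img \<kappa>. transpose (a \<kappa> x) = a \<kappa> x \<and> (\<forall>y. y \<noteq> 0 \<longrightarrow> y \<bullet> (a \<kappa> x *v y) > 0))) \<and>
     (\<forall>\<kappa>\<in>A. \<forall>\<kappa>'\<in>A. \<forall>x\<in>overlap \<kappa> \<kappa>'.
        let J = jacobian (transition \<kappa> \<kappa>') (at x)
        in a \<kappa> x = transpose J ** a \<kappa>' (transition \<kappa> \<kappa>' x) ** J)"

definition one_form ::
    "('m, 'n::finite) chart set \<Rightarrow> (('m, 'n) chart \<Rightarrow> real^'n \<Rightarrow> real^'n) \<Rightarrow> bool" where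
  "one_form A b \<longleftrightarrow>
     (\<forall>\<kappa>\<in>A. smooth_on (chart_img \<kappa>) (b \<kappa>)) \<and>
     (\<forall>\<kappa>\<in>A. \<forall>\<kappa>'\<in>A. \<forall>x\<in>overlap \<kappa> \<kappa>'.
        let J = jacobian (transition \<kappa> \<kappa>') (at x)
        in b \<kappa> x = transpose J *v b \<kappa>' (transition \<kappa> \<kappa>' x))"

definition slit_tangent_function ::
    "('m, 'n::finite) chart set \<Rightarrow> (('m, 'n) chart \<Rightarrow> real^'n \<Rightarrow> real^'n \<Rightarrow> real) \<Rightarrow> bool" where
  "slit_tangent_function A F \<longleftrightarrow>
     (\<forall>\<kappa>\<in>A. \<forall>\<kappa>'\<in>A. \<forall>x\<in>overlap \<kappa> \<kappa>'. \<forall>y. y \<noteq> 0 \<longrightarrow>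
        (let J = jacobian (transition \<kappa> \<kappa>') (at x)
         in F \<kappa> x y = F \<kappa>' (transition \<kappa> \<kappa>' x) (J *v y)))"


subsection \<open>Riemannian quantities in a chart\<close>

definition christoffel :: "(real^'n \<Rightarrow> real^'n^'n) \<Rightarrow> real^'n \<Rightarrow> 'n::finite \<Rightarrow> 'n \<Rightarrow> 'n \<Rightarrow> real" where
  "christoffel m x k i j =
     1/2 * (\<Sum>n\<in>UNIV. matrix_inv (m x) $ k $ n *
       (pd j (\<lambda>z. m z $ n $ i) x + pd i (\<lambda>z. m z $ n $ j) x - pd n (\<lambda>z. m z $ j $ i) x))"

definition unit_length :: "real^'n^'n \<Rightarrow> real^'n::finite \<Rightarrow> bool" where
  "unit_length a\<^sub>x b\<^sub>x \<longleftrightarrow> (\<Sum>i\<in>UNIV. \<Sum>j\<in>UNIV. matrix_inv a\<^sub>x $ i $ j * b\<^sub>x $ i * b\<^sub>x $ j) = 1"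

definition S_fun :: "(real^'n \<Rightarrow> real^'n^'n) \<Rightarrow> real^'n \<Rightarrow> real^'n::finite \<Rightarrow> real" where
  "S_fun a x y = sqrt (\<Sum>i\<in>UNIV. \<Sum>j\<in>UNIV. a x $ i $ j * y $ i * y $ j)"

definition b_fun :: "(real^'n \<Rightarrow> real^'n) \<Rightarrow> real^'n \<Rightarrow> real^'n::finite \<Rightarrow> real" where
  "b_fun b x y = (\<Sum>i\<in>UNIV. b x $ i * y $ i)"

definition b_up :: "(real^'n \<Rightarrow> real^'n^'n) \<Rightarrow> (real^'n \<Rightarrow> real^'n) \<Rightarrow> real^'n \<Rightarrow> real^'n::finite" where
  "b_up a b x = (\<chi> i. \<Sum>j\<in>UNIV. matrix_inv (a x) $ i $ j * b x $ j)"

definition q_fun ::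
    "(real^'n \<Rightarrow> real^'n^'n) \<Rightarrow> (real^'n \<Rightarrow> real^'n) \<Rightarrow> real^'n \<Rightarrow> real^'n::finite \<Rightarrow> real" where
  "q_fun a b x y = sqrt ((S_fun a x y)\<^sup>2 - (b_fun b x y)\<^sup>2)"

definition v_vec ::
    "(real^'n \<Rightarrow> real^'n^'n) \<Rightarrow> (real^'n \<Rightarrow> real^'n) \<Rightarrow> real^'n \<Rightarrow> real^'n::finite \<Rightarrow> real^'n" where
  "v_vec a b x y = y - b_fun b x y *\<^sub>R b_up a b x"

definition regular_domain ::
    "(('m, 'n::finite) chart \<Rightarrow> real^'n \<Rightarrow> real^'n^'n) \<Rightarrow> (('m, 'n) chart \<Rightarrow> real^'n \<Rightarrow> real^'n)
     \<Rightarrow> ('m, 'n) chart \<Rightarrow> ((real^'n) \<times> (real^'n)) set" where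
  "regular_domain a b \<kappa> =
     {(x, y). x \<in> chart_img \<kappa> \<and> y \<noteq> 0 \<and> q_fun (a \<kappa>) (b \<kappa>) x y \<noteq> 0}"


subsection \<open>Finslerian quantities in a chart\<close>

definition y_low :: "(real^'n \<Rightarrow> real^'n \<Rightarrow> real) \<Rightarrow> real^'n \<Rightarrow> real^'n \<Rightarrow> 'n::finite \<Rightarrow> real" where
  "y_low F x y i = 1/2 * pd i (\<lambda>z. (F x z)\<^sup>2) y"

definition finsler_tensor ::
    "(real^'n \<Rightarrow> real^'n \<Rightarrow> real) \<Rightarrow> real^'n \<Rightarrow> real^'n \<Rightarrow> real^'n^'n::finite" where
  "finsler_tensor F x y = (\<chi> i j. 1/2 * pd i (pd j (\<lambda>z. (F x z)\<^sup>2)) y)"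

text \<open>The Finslerian Christoffel symbols differentiate \<open>g\<close> with respect to \<open>x\<close> at fixed \<open>y\<close>; the
  spray carries no factor \<open>1/2\<close>.\<close>

definition spray :: "(real^'n \<Rightarrow> real^'n \<Rightarrow> real) \<Rightarrow> 'n::finite \<Rightarrow> real^'n \<Rightarrow> real^'n \<Rightarrow> real" where
  "spray F k x y =
     (\<Sum>i\<in>UNIV. \<Sum>j\<in>UNIV. christoffel (\<lambda>z. finsler_tensor F z y) x k i j * y $ i * y $ j)"

definition spray3 ::
    "(real^'n \<Rightarrow> real^'n \<Rightarrow> real) \<Rightarrow> 'n::finite \<Rightarrow> 'n \<Rightarrow> 'n \<Rightarrow> 'n \<Rightarrow> real^'n \<Rightarrow> real^'n \<Rightarrow> real" where
  "spray3 F i k m n x y = pd k (pd m (pd n (spray F i x))) y"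

definition landsberg_tensor ::
    "(real^'n \<Rightarrow> real^'n \<Rightarrow> real) \<Rightarrow> 'n::finite \<Rightarrow> 'n \<Rightarrow> 'n \<Rightarrow> real^'n \<Rightarrow> real^'n \<Rightarrow> real" where
  "landsberg_tensor F j k l x y = - 1/4 * (\<Sum>i\<in>UNIV. y_low F x y i * spray3 F i j k l x y)"


subsection \<open>Finsler metric functions and Landsberg type\<close>

text \<open>\<open>D \<kappa>\<close> is the representation in the chart \<open>\<kappa>\<close> of the part of the slit tangent bundle on which
  \<open>F\<close> is required to be regular. Homogeneity is required on the whole slit tangent bundle;
  positivity of \<open>F\<close> and definiteness of \<open>g\<close> are not part of the definition.\<close>

definition finsler_metric_function ::
    "('m, 'n::finite) chart set \<Rightarrow> (('m, 'n) chart \<Rightarrow> ((real^'n) \<times> (real^'n)) set)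
     \<Rightarrow> (('m, 'n) chart \<Rightarrow> real^'n \<Rightarrow> real^'n \<Rightarrow> real) \<Rightarrow> bool" where
  "finsler_metric_function A D F \<longleftrightarrow>
     slit_tangent_function A F \<and>
     (\<forall>\<kappa>\<in>A.
        (\<forall>x\<in>chart_img \<kappa>. \<forall>y. \<forall>t>0. y \<noteq> 0 \<longrightarrow> F \<kappa> x (t *\<^sub>R y) = t * F \<kappa> x y) \<and>
        smooth_on (D \<kappa>) (\<lambda>(x, y). F \<kappa> x y) \<and>
        (\<forall>(x, y)\<in>D \<kappa>. invertible (finsler_tensor (F \<kappa>) x y)))"

definition landsberg_type ::
    "('m, 'n::finite) chart set \<Rightarrow> (('m, 'n) chart \<Rightarrow> ((real^'n) \<times> (real^'n)) set)
     \<Rightarrow> (('m, 'n) chart \<Rightarrow> real^'n \<Rightarrow> real^'n \<Rightarrow> real) \<Rightarrow> bool" where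
  "landsberg_type A D F \<longleftrightarrow>
     (\<forall>\<kappa>\<in>A. \<forall>(x, y)\<in>D \<kappa>. \<forall>j k l. landsberg_tensor (F \<kappa>) j k l x y = 0)"

end

theory Submission
  imports Defs
begin

text \<open>Let \<open>h\<close> be \<open>a\<close> minus the square of \<open>b\<close>, so that \<open>q\<^sup>2\<close> is a quadratic form in \<open>y\<close> with
  matrix \<open>h\<close>. Up to a quadratic polynomial, \<open>G\<^sup>i\<close> is \<open>c q v\<^sup>i\<close>, so \<open>T\<^sup>i = G\<^sup>i\<^sub>k\<^sub>m\<^sub>n\<close> is a linear
  combination of values of the projection \<open>v\<close>; it is thus annihilated by \<open>b\<close>, and its \<open>a\<close>-product
  with \<open>v\<close> is \<open>c q/2\<close> times the third derivative of the quadratic polynomial \<open>q\<^sup>2\<close>, that is, zero.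
  A vector \<open>T\<close> with these two properties is tangent to a curve obtained by rotating \<open>v\<close>, on which \<open>S\<close>
  and \<open>b\<close> are constant. Since \<open>F\<close> depends on \<open>S\<close> and \<open>b\<close> only, its derivative in direction \<open>T\<close>
  vanishes.\<close>

section \<open>Partial derivatives and total derivatives\<close>

lemma pd_eqI:
  "((\<lambda>t. f (x + t *\<^sub>R axis i 1)) has_real_derivative D) (at 0) \<Longrightarrow> pd i f x = D"
  unfolding pd_def by (rule DERIV_imp_deriv)

lemma pd_has_derivative:
  assumes "(f has_derivative f') (at x)"
  shows "pd i f x = f' (axis i 1)"
proof -
  have "((\<lambda>t. f (x + t *\<^sub>R axis i 1)) has_derivative (\<lambda>t. f' (t *\<^sub>R axis i 1))) (at 0)"
    by (rule has_derivative_compose[of "\<lambda>t. x + t *\<^sub>R axis i 1" _ 0 UNIV f f'])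
       (use assms in \<open>auto intro!: derivative_eq_intros\<close>)
  moreover have "(\<lambda>t. f' (t *\<^sub>R axis i 1)) = (*) (f' (axis i 1))"
    using linear_scale[OF has_derivative_linear[OF assms]] by (auto simp: mult.commute)
  ultimately show ?thesis
    by (intro pd_eqI) (simp add: has_field_derivative_def)
qed

lemma sum_pd_has_derivative:
  fixes f :: "real^'n::finite \<Rightarrow> real"
  assumes "(f has_derivative f') (at x)"
  shows "(\<Sum>i\<in>UNIV. pd i f x * w $ i) = f' w"
proof -
  have lin: "linear f'"
    using assms by (rule has_derivative_linear)
  have "f' w = f' (\<Sum>i\<in>UNIV. w $ i *\<^sub>R axis i 1)"
    by (simp add: basis_expansion flip: scalar_mult_eq_scaleR)
  also have "\<dots> = (\<Sum>i\<in>UNIV. pd i f x * w $ i)"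
    by (simp add: linear_sum[OF lin] linear_scale[OF lin] pd_has_derivative[OF assms] mult.commute)
  finally show ?thesis ..
qed

text \<open>A partial derivative depends only on values near \<open>x\<close>. This lets iterated
  derivatives be computed from formulas known only where q is nonzero.\<close>

lemma pd_cong_open:
  assumes "open U" "x \<in> U" "\<And>z. z \<in> U \<Longrightarrow> f z = g z"
  shows "pd i f x = pd i g x"
proof -
  have "((\<lambda>t. x + t *\<^sub>R axis i 1) \<longlongrightarrow> x + 0 *\<^sub>R axis i 1) (nhds (0::real))"
    by (intro tendsto_intros filterlim_ident)
  then have "\<forall>\<^sub>F t in nhds 0. x + t *\<^sub>R axis i 1 \<in> U"
    using assms by (intro topological_tendstoD) auto
  then have "\<forall>\<^sub>F t in nhds 0. f (x + t *\<^sub>R axis i 1) = g (x + t *\<^sub>R axis i 1)"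
    by eventually_elim (rule assms(3))
  then show ?thesis
    unfolding pd_def by (rule deriv_cong_ev) simp
qed

lemma sum_sum_eq_inner:
  fixes A :: "real^'n::finite^'n"
  shows "(\<Sum>i\<in>UNIV. \<Sum>j\<in>UNIV. A $ i $ j * y $ i * z $ j) = y \<bullet> (A *v z)"
  by (simp add: inner_vec_def matrix_vector_mult_def sum_distrib_left mult_ac)

section \<open>Linear algebra in a single tangent space\<close>

locale unit_covector =
  fixes A :: "real^'n::finite^'n" and \<beta> :: "real^'n"
  assumes sym: "transpose A = A"
    and pos: "y \<noteq> 0 \<Longrightarrow> 0 < y \<bullet> (A *v y)"
    and unit: "\<beta> \<bullet> (matrix_inv A *v \<beta>) = 1"
begin

text \<open>\<open>sharp\<close> is the raised covector, \<open>proj\<close> the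
  \<open>A\<close>-orthogonal projection v onto the kernel of \<open>\<beta>\<close>,
  \<open>low\<close> multiplication by the matrix h of the square of q, and \<open>Q\<close> is q
  itself.\<close>

definition "sharp = matrix_inv A *v \<beta>"
definition "proj y = y - (\<beta> \<bullet> y) *\<^sub>R sharp"
definition "low y = A *v y - (\<beta> \<bullet> y) *\<^sub>R \<beta>"
definition "Q y = sqrt (y \<bullet> low y)"

lemma A_commute: "y \<bullet> (A *v z) = z \<bullet> (A *v y)"
  by (metis sym dot_lmul_matrix inner_commute transpose_matrix_vector)

lemma A_sharp: "A *v sharp = \<beta>"
proof -
  \<comment> \<open>\<open>matrix_inv\<close> is defined by choice, so invertibility must come
    first; definiteness makes the kernel trivial.\<close>
  have "invertible A"
  proof -
    have "x = 0" if "A *v x = 0" for x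
      using pos[of x] that by auto
    then show ?thesis
      by (simp add: invertible_left_inverse matrix_left_invertible_ker)
  qed
  then have "A ** matrix_inv A = mat 1"
    unfolding invertible_def matrix_inv_def by (rule someI2_ex) blast
  then show ?thesis
    by (simp add: sharp_def matrix_vector_mul_assoc)
qed

lemma \<beta>_sharp: "\<beta> \<bullet> sharp = 1"
  using unit by (simp add: sharp_def)

lemma \<beta>_proj: "\<beta> \<bullet> proj y = 0"
  by (simp add: proj_def inner_diff_right \<beta>_sharp)

lemma A_proj: "A *v proj y = low y"
  by (simp add: proj_def low_def matrix_vector_mult_diff_distrib matrix_vector_mult_scaleR A_sharp)

text \<open>\<open>y\<close> and \<open>proj y\<close> differ by a multiple of \<open>sharp\<close>,
  which \<open>low z\<close> annihilates.\<close>

lemma proj_low: "proj y \<bullet> low z = y \<bullet> low z"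
proof -
  have "sharp \<bullet> (A *v z) = \<beta> \<bullet> z"
    using A_commute[of sharp z] by (simp add: A_sharp inner_commute)
  then show ?thesis
    by (simp add: proj_def low_def inner_diff_left inner_diff_right inner_commute[of sharp \<beta>]
        inner_commute[of y \<beta>] \<beta>_sharp)
qed

lemma low_commute: "y \<bullet> low z = z \<bullet> low y"
  by (simp add: low_def inner_diff_right A_commute[of y z] inner_commute mult.commute)

lemma low_nonneg: "0 \<le> y \<bullet> low y"
proof -
  have "y \<bullet> low y = proj y \<bullet> (A *v proj y)"
    by (simp add: A_proj proj_low)
  then show ?thesis
    using pos[of "proj y"] by (cases "proj y = 0") auto
qed

lemma low_add: "low (y + z) = low y + low z"
  and low_scale: "low (r *\<^sub>R y) = r *\<^sub>R low y"
  by (simp_all add: low_def matrix_vector_right_distrib matrix_vector_mult_scaleR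
      inner_add_right scaleR_add_left scaleR_diff_right)

lemma proj_add: "proj (y + z) = proj y + proj z"
  and proj_scale: "proj (r *\<^sub>R y) = r *\<^sub>R proj y"
  by (simp_all add: proj_def inner_add_right scaleR_add_left scaleR_diff_right)

lemma Q_sq: "(Q y)\<^sup>2 = y \<bullet> low y"
  by (simp add: Q_def low_nonneg)

lemma open_Q: "open {y. Q y \<noteq> 0}"
proof -
  have "continuous_on UNIV Q"
    unfolding Q_def low_def by (intro continuous_intros)
  then show ?thesis
    by (intro open_Collect_neq) (auto intro: continuous_intros)
qed

lemma Q_zero: "Q 0 = 0"
  by (simp add: Q_def)

section \<open>Derivatives along lines\<close>

lemma deriv_Q:
  assumes "Q y \<noteq> 0"
  shows "((\<lambda>t. Q (y + t *\<^sub>R w)) has_real_derivative (w \<bullet> low y) / Q y) (at 0)"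
proof -
  have "Q (y + t *\<^sub>R w) = sqrt (y \<bullet> low y + 2 * t * (w \<bullet> low y) + t\<^sup>2 * (w \<bullet> low w))" for t
    by (simp add: Q_def low_add low_scale inner_add_left inner_add_right low_commute[of y w]
        algebra_simps power2_eq_square)
  moreover have "0 < y \<bullet> low y"
    using assms low_nonneg[of y] by (auto simp: Q_def less_le)
  ultimately show ?thesis
    by (auto intro!: derivative_eq_intros simp: Q_def field_simps)
qed

lemma deriv_low: "((\<lambda>t. low (y + t *\<^sub>R w) $ n) has_real_derivative low w $ n) (at 0)"
  unfolding low_add low_scale by (auto intro!: derivative_eq_intros)

lemma deriv_proj: "((\<lambda>t. proj (y + t *\<^sub>R w) $ n) has_real_derivative proj w $ n) (at 0)"
  unfolding proj_add proj_scale by (auto intro!: derivative_eq_intros)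

lemma low_axis_commute: "low (axis m 1) $ n = low (axis n 1) $ m"
  using low_commute[of "axis n 1" "axis m 1"] by (simp add: inner_axis')

text \<open>Naming the reciprocal keeps the higher derivatives polynomial in \<open>Q\<close>,
  \<open>R\<close>, \<open>low\<close> and \<open>proj\<close>, without nested quotients.\<close>

definition "R y = inverse (Q y)"

lemma deriv_R:
  assumes "Q y \<noteq> 0"
  shows "((\<lambda>t. R (y + t *\<^sub>R w)) has_real_derivative - (w \<bullet> low y) * R y ^ 3) (at 0)"
  unfolding R_def
  by (rule derivative_eq_intros deriv_Q refl | simp add: assms)+
     (simp add: field_simps eval_nat_numeral)

section \<open>The first three derivatives of q v\<close>

definition "dQproj i n y = low y $ n * R y * proj y $ i + Q y * proj (axis n 1) $ i"

definition "d2Qproj i n m y =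
  (low (axis n 1) $ m * R y - low y $ n * low y $ m * R y ^ 3) * proj y $ i
  + low y $ n * R y * proj (axis m 1) $ i + low y $ m * R y * proj (axis n 1) $ i"

text \<open>Given as a whole vector rather than by components: each term is a scalar times a value
  of \<open>proj\<close>, ready for pairing with \<open>\<beta>\<close> and
  \<open>low y\<close>.\<close>

definition "d3Qproj n m k y =
  (3 * (low y $ n * low y $ m * low y $ k) * R y ^ 5 - (low (axis n 1) $ m * low y $ k
     + low (axis n 1) $ k * low y $ m + low (axis m 1) $ k * low y $ n) * R y ^ 3) *\<^sub>R proj y
  + (low (axis n 1) $ m * R y - low y $ n * low y $ m * R y ^ 3) *\<^sub>R proj (axis k 1)
  + (low (axis n 1) $ k * R y - low y $ n * low y $ k * R y ^ 3) *\<^sub>R proj (axis m 1)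
  + (low (axis m 1) $ k * R y - low y $ m * low y $ k * R y ^ 3) *\<^sub>R proj (axis n 1)"

lemma \<beta>_d3Qproj: "\<beta> \<bullet> d3Qproj n m k y = 0"
  by (simp add: d3Qproj_def inner_add_right \<beta>_proj)

text \<open>Pairing with \<open>low y\<close> turns \<open>proj y\<close> into the square of
  \<open>Q y\<close> and \<open>proj (axis j 1)\<close> into \<open>low y $ j\<close>. The square
  lowers each power of \<open>R y\<close> by two, and the first summand cancels the other
  three.\<close>

lemma d3Qproj_low:
  assumes "Q y \<noteq> 0"
  shows "d3Qproj n m k y \<bullet> low y = 0"
proof -
  have *: "proj y \<bullet> low y = (Q y)\<^sup>2" "\<And>j. proj (axis j 1) \<bullet> low y = low y $ j"
    by (simp_all add: proj_low Q_sq inner_axis')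
  have "R y ^ 5 * (Q y)\<^sup>2 = R y ^ 3" "R y ^ 3 * (Q y)\<^sup>2 = R y"
    using assms by (simp_all add: R_def field_simps eval_nat_numeral)
  then have "(u * R y ^ 5 - w * R y ^ 3) * (Q y)\<^sup>2 = u * R y ^ 3 - w * R y" for u w
    by (simp add: left_diff_distrib mult.assoc)
  then show ?thesis
    by (simp add: d3Qproj_def inner_add_left *) (simp add: algebra_simps)
qed

text \<open>The quadratic polynomial \<open>\<Gamma>\<close> is carried along, since \<open>pd\<close> is additive only on differentiable
  functions.\<close>

context
  fixes c :: real and \<Gamma> :: "real^'n^'n" and i :: 'n and y :: "real^'n"
  assumes Qy: "Q y \<noteq> 0"
begin

lemma pd_Qproj:
  "pd n (\<lambda>z. c * Q z * proj z $ i + z \<bullet> (\<Gamma> *v z)) y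
     = c * dQproj i n y + ((\<Gamma> + transpose \<Gamma>) *v y) $ n"
proof (rule pd_eqI)
  have quad: "((\<lambda>t. (y + t *\<^sub>R axis n 1) \<bullet> (\<Gamma> *v (y + t *\<^sub>R axis n 1))) has_real_derivative
      ((\<Gamma> + transpose \<Gamma>) *v y) $ n) (at 0)"
  proof -
    have "y \<bullet> (\<Gamma> *v axis n 1) = axis n 1 \<bullet> (transpose \<Gamma> *v y)"
      by (metis dot_lmul_matrix inner_commute transpose_matrix_vector)
    then have "(y + t *\<^sub>R axis n 1) \<bullet> (\<Gamma> *v (y + t *\<^sub>R axis n 1)) = y \<bullet> (\<Gamma> *v y)
        + t * ((\<Gamma> + transpose \<Gamma>) *v y) $ n + t\<^sup>2 * (axis n 1 \<bullet> (\<Gamma> *v axis n 1))" for t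
      by (simp add: matrix_vector_right_distrib matrix_vector_mult_scaleR inner_add_left
          inner_add_right matrix_vector_mult_add_rdistrib inner_axis inner_commute[of "axis n 1"]
          algebra_simps power2_eq_square)
    then show ?thesis
      by (auto intro!: derivative_eq_intros)
  qed
  show "((\<lambda>t. c * Q (y + t *\<^sub>R axis n 1) * proj (y + t *\<^sub>R axis n 1) $ i
      + (y + t *\<^sub>R axis n 1) \<bullet> (\<Gamma> *v (y + t *\<^sub>R axis n 1))) has_real_derivative
      c * dQproj i n y + ((\<Gamma> + transpose \<Gamma>) *v y) $ n) (at 0)"
    by (rule derivative_eq_intros deriv_Q deriv_proj quad Qy refl)+
       (simp add: dQproj_def R_def divide_inverse inner_axis' algebra_simps)
qed

lemma pd_dQproj:
  "pd m (\<lambda>z. c * dQproj i n z + (\<Gamma> *v z) $ n) y = c * d2Qproj i n m y + \<Gamma> $ n $ m"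
proof (rule pd_eqI)
  have lin: "((\<lambda>t. (\<Gamma> *v (y + t *\<^sub>R axis m 1)) $ n) has_real_derivative \<Gamma> $ n $ m) (at 0)"
    by (auto intro!: derivative_eq_intros simp: matrix_vector_right_distrib
        matrix_vector_mult_scaleR matrix_vector_mult_basis column_def)
  show "((\<lambda>t. c * dQproj i n (y + t *\<^sub>R axis m 1) + (\<Gamma> *v (y + t *\<^sub>R axis m 1)) $ n)
      has_real_derivative c * d2Qproj i n m y + \<Gamma> $ n $ m) (at 0)"
    unfolding dQproj_def
    by (rule derivative_eq_intros deriv_Q deriv_proj deriv_low deriv_R lin refl | simp add: Qy)+
       (simp add: d2Qproj_def R_def[symmetric] divide_inverse inner_axis' low_axis_commute[of m n]
          algebra_simps eval_nat_numeral)
qed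

lemma pd_d2Qproj: "pd k (\<lambda>z. c * d2Qproj i n m z + d) y = c * d3Qproj n m k y $ i"
proof (rule pd_eqI)
  show "((\<lambda>t. c * d2Qproj i n m (y + t *\<^sub>R axis k 1) + d) has_real_derivative c * d3Qproj n m k y $ i) (at 0)"
    unfolding d2Qproj_def
    by (rule derivative_eq_intros deriv_Q deriv_proj deriv_low deriv_R refl | simp add: Qy)+
       (simp add: d3Qproj_def inner_axis' low_axis_commute[of k] algebra_simps eval_nat_numeral)
qed

end

text \<open>Each differentiation needs the previous formula on a neighbourhood, supplied by
  \<open>open_Q\<close>. The quadratic part is constant after two derivatives and vanishes at the
  third.\<close>

lemma pd3_spray_form:
  assumes "Q y \<noteq> 0"
    and G: "\<And>z. Q z \<noteq> 0 \<Longrightarrow> G z = c * Q z * proj z $ i + z \<bullet> (\<Gamma> *v z)"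
  shows "pd k (pd m (pd n G)) y = c * d3Qproj n m k y $ i"
proof -
  let ?U = "{z. Q z \<noteq> 0}"
  have 1: "pd n G z = c * dQproj i n z + ((\<Gamma> + transpose \<Gamma>) *v z) $ n" if "z \<in> ?U" for z
    using pd_cong_open[OF open_Q that, of G "\<lambda>z. c * Q z * proj z $ i + z \<bullet> (\<Gamma> *v z)"] G
      pd_Qproj that by simp
  \<comment> \<open>\<open>pd_dQproj\<close> is used with
    \<open>\<Gamma> + transpose \<Gamma>\<close> as its matrix.\<close>
  have 2: "pd m (pd n G) z = c * d2Qproj i n m z + (\<Gamma> + transpose \<Gamma>) $ n $ m" if "z \<in> ?U" for z
    using pd_cong_open[OF open_Q that 1] pd_dQproj that by simp
  show ?thesis
    using pd_cong_open[OF open_Q _ 2] pd_d2Qproj assms(1) by simp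
qed

section \<open>Functions of S and b along rotations of v\<close>

lemma derivative_tangent_zero:
  assumes \<Phi>: "(\<Phi> has_derivative \<Phi>') (at y)"
    and dep: "\<And>z. z \<noteq> 0 \<Longrightarrow> \<Phi> z = f (z \<bullet> (A *v z)) (\<beta> \<bullet> z)"
    and Qy: "Q y \<noteq> 0" and T: "\<beta> \<bullet> T = 0" "T \<bullet> low y = 0"
  shows "\<Phi>' T = 0"
proof (cases "T = 0")
  case True
  then show ?thesis
    using linear_0[OF has_derivative_linear[OF \<Phi>]] by simp
next
  case False
  define N where "N = T \<bullet> (A *v T)"
  \<comment> \<open>Chosen so that \<open>s *\<^sub>R T\<close> has the same \<open>A\<close>-length
    as \<open>proj y\<close>, namely \<open>Q y\<close>.\<close>
  define s where "s = Q y / sqrt N"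
  have N: "0 < N"
    using pos[OF False] by (simp add: N_def)
  have s: "s \<noteq> 0" "s\<^sup>2 * N = (Q y)\<^sup>2"
    using N Qy by (simp_all add: s_def power_divide)
  have y0: "y \<noteq> 0"
    using Qy Q_zero by auto
  \<comment> \<open>As \<open>f\<close> is arbitrary, no chain rule through it is available;
    constancy along a curve replaces it. The component of \<open>y\<close> along
    \<open>sharp\<close> stays fixed while \<open>proj y\<close> rotates towards
    \<open>s *\<^sub>R T\<close>.\<close>
  define \<gamma> where "\<gamma> t = y + (cos t - 1) *\<^sub>R proj y + (s * sin t) *\<^sub>R T" for t
  have \<gamma>\<beta>: "\<beta> \<bullet> \<gamma> t = \<beta> \<bullet> y" for t
    by (simp add: \<gamma>_def inner_add_right \<beta>_proj T)
  have \<gamma>A: "\<gamma> t \<bullet> (A *v \<gamma> t) = y \<bullet> (A *v y)" for t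
  proof -
    have "T \<bullet> (A *v y) = 0"
      using T by (simp add: low_def inner_diff_right inner_commute)
    then have yT: "y \<bullet> (A *v T) = 0"
      using A_commute by simp
    have "\<gamma> t \<bullet> (A *v \<gamma> t) = y \<bullet> (A *v y) + 2 * (cos t - 1) * (Q y)\<^sup>2 + (cos t - 1)\<^sup>2 * (Q y)\<^sup>2
        + (s * sin t)\<^sup>2 * N"
      using yT \<open>T \<bullet> (A *v y) = 0\<close> T A_commute[of "proj y" y] A_commute[of "proj y" T]
      by (simp add: \<gamma>_def matrix_vector_right_distrib matrix_vector_mult_scaleR inner_add_left
          inner_add_right A_proj proj_low Q_sq[unfolded power2_eq_square] N_def power2_eq_square
          algebra_simps)
    also have "\<dots> = y \<bullet> (A *v y) + ((cos t)\<^sup>2 - 1) * (Q y)\<^sup>2 + (sin t)\<^sup>2 * (s\<^sup>2 * N)"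
      by (simp add: power2_eq_square algebra_simps)
    also have "\<dots> = y \<bullet> (A *v y)"
      unfolding s(2) by (simp add: sin_squared_eq algebra_simps)
    finally show ?thesis .
  qed
  \<comment> \<open>\<open>dep\<close> speaks only of nonzero vectors, so the curve must avoid the
    origin.\<close>
  have "\<gamma> t \<noteq> 0" for t
    using \<gamma>A[of t] pos[OF y0] by auto
  then have const: "\<Phi> (\<gamma> t) = \<Phi> y" for t
    using dep \<gamma>\<beta> \<gamma>A y0 by simp
  \<comment> \<open>The cosine is stationary at 0, so the velocity there is
    \<open>s *\<^sub>R T\<close>.\<close>
  have "(\<gamma> has_derivative (\<lambda>t. (s * t) *\<^sub>R T)) (at 0)"
    unfolding \<gamma>_def by (auto intro!: derivative_eq_intros)
  then have "((\<lambda>t. \<Phi> (\<gamma> t)) has_derivative (\<lambda>t. \<Phi>' ((s * t) *\<^sub>R T))) (at 0)"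
    by (rule has_derivative_compose) (use \<Phi> in \<open>simp add: \<gamma>_def\<close>)
  then have "((\<lambda>t::real. \<Phi> y) has_derivative (\<lambda>t. \<Phi>' ((s * t) *\<^sub>R T))) (at 0)"
    by (simp add: const)
  then have "(\<lambda>t. \<Phi>' ((s * t) *\<^sub>R T)) = (\<lambda>t. 0)"
    by (rule has_derivative_unique) simp
  then have "\<Phi>' ((s * 1) *\<^sub>R T) = 0"
    by meson
  then show ?thesis
    using s linear_scale[OF has_derivative_linear[OF \<Phi>]] by simp
qed

end

section \<open>Application in each chart\<close>

theorem proposition1:
  fixes M :: "'m topology"
    and A :: "('m, 'n::finite) chart set"
    and a :: "('m, 'n) chart \<Rightarrow> real^'n \<Rightarrow> real^'n^'n"
    and b :: "('m, 'n) chart \<Rightarrow> real^'n \<Rightarrow> real^'n"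
    and F :: "('m, 'n) chart \<Rightarrow> real^'n \<Rightarrow> real^'n \<Rightarrow> real"
    and c :: "'m \<Rightarrow> real"
    and Fb :: "real \<Rightarrow> real \<Rightarrow> real"
  assumes dim: "CARD('n) \<ge> 2"
    and manifold: "smooth_manifold M A"
    and metric: "riemannian_metric A a"
    and form: "one_form A b"
    and unit: "\<forall>\<kappa>\<in>A. \<forall>x\<in>chart_img \<kappa>. unit_length (a \<kappa> x) (b \<kappa> x)"
    and finsler: "finsler_metric_function A (regular_domain a b) F"
    and spray_form: "\<forall>\<kappa>\<in>A. \<forall>(x, y)\<in>regular_domain a b \<kappa>. \<forall>i.
       spray (F \<kappa>) i x y =
         c (chart_inv \<kappa> x) * q_fun (a \<kappa>) (b \<kappa>) x y * v_vec (a \<kappa>) (b \<kappa>) x y $ i +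
         (\<Sum>k\<in>UNIV. \<Sum>m\<in>UNIV. christoffel (a \<kappa>) x i k m * y $ k * y $ m)"
    and F_form: "\<forall>\<kappa>\<in>A. \<forall>x\<in>chart_img \<kappa>. \<forall>y. y \<noteq> 0 \<longrightarrow>
       F \<kappa> x y = Fb (S_fun (a \<kappa>) x y) (b_fun (b \<kappa>) x y)"
  shows "(\<forall>\<kappa>\<in>A. \<forall>(x, y)\<in>regular_domain a b \<kappa>. \<forall>k m n.
            (\<Sum>i\<in>UNIV. y_low (F \<kappa>) x y i * spray3 (F \<kappa>) i k m n x y) = 0) \<and>
         landsberg_type A (regular_domain a b) F"
proof -
  have main: "(\<Sum>i\<in>UNIV. y_low (F \<kappa>) x y i * spray3 (F \<kappa>) i k m n x y) = 0"
    if \<kappa>: "\<kappa> \<in> A" and xy: "(x, y) \<in> regular_domain a b \<kappa>" for \<kappa> x y k m n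
  proof -
    have x: "x \<in> chart_img \<kappa>" and y0: "y \<noteq> 0" and qy: "q_fun (a \<kappa>) (b \<kappa>) x y \<noteq> 0"
      using xy by (auto simp: regular_domain_def)
    have "b \<kappa> x \<bullet> (matrix_inv (a \<kappa> x) *v b \<kappa> x) = 1"
      using unit \<kappa> x by (simp add: unit_length_def sum_sum_eq_inner)
    then interpret unit_covector "a \<kappa> x" "b \<kappa> x"
      using metric \<kappa> x by unfold_locales (auto simp: riemannian_metric_def)
    have S: "S_fun (a \<kappa>) x z = sqrt (z \<bullet> (a \<kappa> x *v z))" for z
      by (simp add: S_fun_def sum_sum_eq_inner)
    have B: "b_fun (b \<kappa>) x z = b \<kappa> x \<bullet> z" for z
      by (simp add: b_fun_def inner_vec_def)
    have q: "q_fun (a \<kappa>) (b \<kappa>) x z = Q z" for z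
    proof -
      have "0 \<le> z \<bullet> (a \<kappa> x *v z)"
        using pos[of z] by (cases "z = 0") auto
      then show ?thesis
        by (simp add: q_fun_def S B Q_def low_def inner_diff_right power2_eq_square inner_commute)
    qed
    have v: "v_vec (a \<kappa>) (b \<kappa>) x z = proj z" for z
      by (simp add: v_vec_def B b_up_def proj_def sharp_def matrix_vector_mult_def)
    have dom: "(x, z) \<in> regular_domain a b \<kappa>" if "Q z \<noteq> 0" for z
      using that x Q_zero by (auto simp: regular_domain_def q)
    \<comment> \<open>Only \<open>y\<close> varies in the derivatives below, so the factor c is a
      constant.\<close>
    define C where "C = c (chart_inv \<kappa> x)"
    define T where "T = C *\<^sub>R d3Qproj n m k y"
    have Qy: "Q y \<noteq> 0"
      using qy q by simp
    have spray3: "spray3 (F \<kappa>) i k m n x y = T $ i" for i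
    proof -
      define \<Gamma> where "\<Gamma> = (\<chi> k m. christoffel (a \<kappa>) x i k m)"
      have "spray (F \<kappa>) i x z = C * Q z * proj z $ i + z \<bullet> (\<Gamma> *v z)" if "Q z \<noteq> 0" for z
        using spray_form \<kappa> dom[OF that]
        by (fastforce simp: C_def q v \<Gamma>_def simp flip: sum_sum_eq_inner)
      from pd3_spray_form[OF Qy this] show ?thesis
        by (simp add: spray3_def T_def)
    qed
    have "(\<lambda>(x, y). F \<kappa> x y) differentiable (at (x, y))"
    proof -
      \<comment> \<open>Smoothness is joint in \<open>x\<close> and \<open>y\<close>; its first
        order gives a total derivative, then restricted to the fibre over \<open>x\<close>.\<close>
      have "Ck_on 1 (regular_domain a b \<kappa>) (\<lambda>(x, y). F \<kappa> x y)"
        using finsler \<kappa> by (simp only: finsler_metric_function_def smooth_on_def)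
      then show ?thesis
        using xy by simp
    qed
    then obtain F' where F': "((\<lambda>(x, y). F \<kappa> x y) has_derivative F') (at (x, y))"
      by (auto simp: differentiable_def)
    have "((\<lambda>z. (x, z)) has_derivative (\<lambda>h. (0, h))) (at y)"
      by (auto intro!: derivative_eq_intros)
    from has_derivative_compose[OF this F']
    have "((\<lambda>z. F \<kappa> x z) has_derivative (\<lambda>h. F' (0, h))) (at y)"
      by simp
    from has_derivative_power[OF this, of 2]
    obtain \<Phi>' where \<Phi>': "((\<lambda>z. (F \<kappa> x z)\<^sup>2) has_derivative \<Phi>') (at y)"
      by blast
    have "\<Phi>' T = 0"
    proof (rule derivative_tangent_zero[OF \<Phi>' _ Qy])
      \<comment> \<open>The lemma takes the square of S as first argument, hence the root inside
        \<open>Fb\<close>.\<close>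
      show "(F \<kappa> x z)\<^sup>2 = (Fb (sqrt (z \<bullet> (a \<kappa> x *v z))) (b \<kappa> x \<bullet> z))\<^sup>2" if "z \<noteq> 0" for z
        using F_form \<kappa> x that by (simp add: S B)
    qed (simp_all add: T_def \<beta>_d3Qproj d3Qproj_low Qy)
    \<comment> \<open>The contraction is half the differential of the square of F, applied to
      \<open>T\<close>.\<close>
    then show ?thesis
      using sum_pd_has_derivative[OF \<Phi>', of T]
      by (simp add: y_low_def spray3 flip: sum_distrib_left sum_divide_distrib)
  qed
  then show ?thesis
    by (auto simp: landsberg_type_def landsberg_tensor_def)
qed

end
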